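(* Let $K_{a,b}$ be the complete bipartite graph with parts of sizes $a$ and $b$, and let $k$ be a positive integer with $\left\lceil\frac{k}{2}\right\rceil+1\le a\le b$. Then $$b_t^k(K_{a,b})\le \left\lceil\frac{k}{2}\right\rceil\left(a+b-\left\lceil\frac{k}{2}\right\rceil-1\right).$$
   Context: $\gamma_t(K_{a,b})=2$ for $2\le a\le b$. A total dominating set of a graph without isolated vertices is a vertex set $S$ such that every vertex is adjacent to some vertex of $S$; $\gamma_t(G)$ is the minimum size of such a set. The $k$-total bondage number $b_t^k(G)$ is the minimum number of edges that must be deleted from $G$ so that the resulting graph (required to have no isolated vertices) has total domination number at least $\gamma_t(G)+k$. *)

theory Defs
  imports Complex_Main "HOL-Library.Extended_Nat"
begin

text \<open>A finite simple graph is given by its finite vertex set \<open>V\<close> and its edge set \<open>E\<close>,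
  consisting of two-element subsets of \<open>V\<close>; \<open>u\<close> and \<open>v\<close> are adjacent iff \<open>{u, v} \<in> E\<close>.\<close>

definition simple_graph :: "'a set \<Rightarrow> 'a set set \<Rightarrow> bool" where
  "simple_graph V E \<longleftrightarrow> finite V \<and> (\<forall>e\<in>E. e \<subseteq> V \<and> card e = 2)"

definition complete_bipartite_graph :: "nat \<Rightarrow> nat \<Rightarrow> 'a set \<Rightarrow> 'a set set \<Rightarrow> bool" where
  "complete_bipartite_graph a b V E \<longleftrightarrow>
     (\<exists>A B. finite A \<and> finite B \<and> card A = a \<and> card B = b \<and> A \<inter> B = {} \<and>
            V = A \<union> B \<and> E = {{u, v} | u v. u \<in> A \<and> v \<in> B})"

definition no_isolated_vertices :: "'a set \<Rightarrow> 'a set set \<Rightarrow> bool" where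
  "no_isolated_vertices V E \<longleftrightarrow> (\<forall>v\<in>V. \<exists>u\<in>V. {u, v} \<in> E)"

definition total_dominating_set :: "'a set \<Rightarrow> 'a set set \<Rightarrow> 'a set \<Rightarrow> bool" where
  "total_dominating_set V E S \<longleftrightarrow> S \<subseteq> V \<and> (\<forall>v\<in>V. \<exists>u\<in>S. {u, v} \<in> E)"

text \<open>Meaningful for finite graphs without isolated vertices; there \<open>V\<close> itself is a total
  dominating set, so the minimum exists.\<close>

definition total_domination_number :: "'a set \<Rightarrow> 'a set set \<Rightarrow> nat" where
  "total_domination_number V E = (LEAST n. \<exists>S. total_dominating_set V E S \<and> card S = n)"

text \<open>The infimum is taken in \<^typ>\<open>enat\<close>, so the value is \<open>\<infinity>\<close> if no set of edges has the required
  property, and otherwise it is the minimum. A finite upper bound thus asserts that a suitable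
  set of edges exists.\<close>

definition k_total_bondage_number :: "nat \<Rightarrow> 'a set \<Rightarrow> 'a set set \<Rightarrow> enat" where
  "k_total_bondage_number k V E =
     (INF F \<in> {F. F \<subseteq> E \<and> no_isolated_vertices V (E - F) \<and>
                  total_domination_number V (E - F) \<ge> total_domination_number V E + k}.
        enat (card F))"

lemma complete_bipartite_graph_imp_simple_graph:
  assumes "complete_bipartite_graph a b V E"
  shows "simple_graph V E"
proof -
  obtain A B where AB: "finite A" "finite B" "A \<inter> B = {}" "V = A \<union> B"
      "E = {{u, v} | u v. u \<in> A \<and> v \<in> B}"
    using assms unfolding complete_bipartite_graph_def by blast
  have "card {u, v} = 2" if "u \<in> A" "v \<in> B" for u v
    using that AB(3) by (subst card_2_iff) blast
  then show ?thesis
    using AB unfolding simple_graph_def by auto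
qed

end

theory Submission
  imports Defs
begin

text \<open>With \<open>m = \<lceil>k / 2\<rceil>\<close>, delete edges so that what remains is a matching of \<open>m\<close> edges together
  with a disjoint copy of \<open>K\<^bsub>a-m,b-m\<^esub>\<close>. A total dominating set contains every vertex that is the
  only neighbour of another one, hence all \<open>2m\<close> matched vertices, and it needs two more vertices
  for \<open>K\<^bsub>a-m,b-m\<^esub>\<close>; so the total domination number is at least \<open>2m + 2 \<ge> k + 2\<close>.\<close>

text \<open>Orienting every edge from \<open>A\<close> to \<open>B\<close> turns edge sets into
  relations inside \<open>A \<times> B\<close>, so that edges can be counted as pairs.\<close>

definition pair_edges :: "('a \<times> 'a) set \<Rightarrow> 'a set set" where
  "pair_edges R = {{u, v} | u v. (u, v) \<in> R}"

lemma pair_edges_mono: "R \<subseteq> R' \<Longrightarrow> pair_edges R \<subseteq> pair_edges R'"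
  unfolding pair_edges_def by blast

lemma card_pair_edges:
  assumes "R \<subseteq> A \<times> B" and "A \<inter> B = {}"
  shows "card (pair_edges R) = card R"
proof -
  have "inj_on (\<lambda>(u, v). {u, v}) R"
    using assms by (fastforce simp: inj_on_def doubleton_eq_iff)
  moreover have "pair_edges R = (\<lambda>(u, v). {u, v}) ` R"
    unfolding pair_edges_def by auto
  ultimately show ?thesis
    by (simp add: card_image)
qed

text \<open>Disjointness of the parts excludes the reversed pair as soon as one endpoint has a known
  side. The other endpoint \<open>w\<close> stays arbitrary because it will be a member of a
  dominating set, whose side is not known in advance.\<close>

lemma pair_edges_iff:
  assumes "R \<subseteq> A \<times> B" and "A \<inter> B = {}"
  shows "u \<in> A \<Longrightarrow> {w, u} \<in> pair_edges R \<longleftrightarrow> (u, w) \<in> R"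
    and "v \<in> B \<Longrightarrow> {w, v} \<in> pair_edges R \<longleftrightarrow> (w, v) \<in> R"
  using assms unfolding pair_edges_def by (auto simp: doubleton_eq_iff)

lemma total_domination_number_le:
  "total_dominating_set V E S \<Longrightarrow> total_domination_number V E \<le> card S"
  unfolding total_domination_number_def by (rule Least_le) blast

text \<open>Without isolated vertices \<open>V\<close> itself is total dominating, so the
  \<open>LEAST\<close> is attained by some set, to which the assumed bound applies.\<close>

lemma total_domination_number_ge:
  assumes "no_isolated_vertices V E"
    and "\<And>S. total_dominating_set V E S \<Longrightarrow> n \<le> card S"
  shows "n \<le> total_domination_number V E"
proof -
  have "total_dominating_set V E V"
    using assms(1) unfolding no_isolated_vertices_def total_dominating_set_def by blast
  then have "\<exists>n S. total_dominating_set V E S \<and> card S = n"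
    by blast
  then have "\<exists>S. total_dominating_set V E S \<and> card S = total_domination_number V E"
    unfolding total_domination_number_def by (rule LeastI_ex)
  then show ?thesis
    using assms(2) by metis
qed

lemma k_total_bondage_number_le:
  assumes "F \<subseteq> E" and "no_isolated_vertices V (E - F)"
    and "total_domination_number V E + k \<le> total_domination_number V (E - F)"
  shows "k_total_bondage_number k V E \<le> enat (card F)"
  unfolding k_total_bondage_number_def using assms by (intro INF_lower) auto

text \<open>One vertex from each part suffices, since each dominates the whole opposite part. This
  reduces the goal to reaching \<open>k + 2\<close> after the deletion.\<close>

lemma total_domination_number_complete_bipartite_le:
  assumes "A \<noteq> {}" and "B \<noteq> {}"
  shows "total_domination_number (A \<union> B) (pair_edges (A \<times> B)) \<le> 2"
proof -
  obtain u v where uv: "u \<in> A" "v \<in> B"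
    using assms by blast
  have "\<exists>w\<in>{u, v}. {w, x} \<in> pair_edges (A \<times> B)" if "x \<in> A \<union> B" for x
    using that uv unfolding pair_edges_def by (auto simp: insert_commute)
  then have "total_dominating_set (A \<union> B) (pair_edges (A \<times> B)) {u, v}"
    using uv unfolding total_dominating_set_def by auto
  from total_domination_number_le[OF this] show ?thesis
    by (rule order_trans) (simp add: card_insert_if)
qed

text \<open>Strictness of both inclusions keeps the two sides of the complete bipartite remainder
  nonempty. This gives its vertices neighbours and yields the summand 2.\<close>

lemma matching_plus_bipartite_total_domination:
  fixes f :: "'a \<Rightarrow> 'a"
  assumes fin: "finite A" "finite B" and disj: "A \<inter> B = {}"
    and sub: "A0 \<subset> A" "B0 \<subset> B" and f: "bij_betw f A0 B0"
  defines "R \<equiv> (\<lambda>u. (u, f u)) ` A0 \<union> (A - A0) \<times> (B - B0)"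
  shows "no_isolated_vertices (A \<union> B) (pair_edges R)"
    and "2 * card A0 + 2 \<le> total_domination_number (A \<union> B) (pair_edges R)"
proof -
  have fA0: "f ` A0 = B0" and inj: "inj_on f A0"
    using f by (auto simp: bij_betw_def)
  have R: "R \<subseteq> A \<times> B"
    using sub fA0 unfolding R_def by auto
  note iff = pair_edges_iff[OF R disj]
  obtain a1 b1 where a1: "a1 \<in> A - A0" and b1: "b1 \<in> B - B0"
    using sub by blast
  show ni: "no_isolated_vertices (A \<union> B) (pair_edges R)"
    unfolding no_isolated_vertices_def
  proof
    fix v assume "v \<in> A \<union> B"
    then consider "v \<in> A0" | "v \<in> A - A0" | "v \<in> B0" | "v \<in> B - B0"
      by blast
    then show "\<exists>u\<in>A \<union> B. {u, v} \<in> pair_edges R"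
    proof cases
      case 1
      then have "(v, f v) \<in> R" unfolding R_def by blast
      then show ?thesis using R unfolding pair_edges_def by (auto simp: insert_commute)
    next
      case 2
      then have "(v, b1) \<in> R" using b1 unfolding R_def by blast
      then show ?thesis using R unfolding pair_edges_def by (auto simp: insert_commute)
    next
      case 3
      then obtain u where "(u, v) \<in> R" using fA0 unfolding R_def by blast
      then show ?thesis using R unfolding pair_edges_def by blast
    next
      case 4
      then have "(a1, v) \<in> R" using a1 unfolding R_def by blast
      then show ?thesis using R unfolding pair_edges_def by blast
    qed
  qed
  show "2 * card A0 + 2 \<le> total_domination_number (A \<union> B) (pair_edges R)"
  proof (rule total_domination_number_ge[OF ni])
    fix S assume S: "total_dominating_set (A \<union> B) (pair_edges R) S"
    have domA: "\<exists>w\<in>S. (u, w) \<in> R" if "u \<in> A" for u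
      using S that iff(1)[OF that] unfolding total_dominating_set_def by blast
    have domB: "\<exists>w\<in>S. (w, v) \<in> R" if "v \<in> B" for v
      using S that iff(2)[OF that] unfolding total_dominating_set_def by blast
    have A0S: "A0 \<subseteq> S"
    proof
      fix u assume u: "u \<in> A0"
      then have fu: "f u \<in> B0" using fA0 by blast
      then obtain w where "w \<in> S" "(w, f u) \<in> R" using domB sub by blast
      \<comment> \<open>As \<open>f u\<close> lies in \<open>B0\<close>, the pair comes from the
        matching, and injectivity of \<open>f\<close> leaves \<open>u\<close> as the only neighbour
        of \<open>f u\<close>.\<close>
      moreover from this have "w = u"
        using u fu inj unfolding R_def by (auto dest: inj_onD)
      ultimately show "u \<in> S" by simp
    qed
    have B0S: "B0 \<subseteq> S"
    proof
      fix v assume "v \<in> B0"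
      then obtain u where u: "u \<in> A0" "v = f u" using fA0 by blast
      then obtain w where "w \<in> S" "(u, w) \<in> R" using domA sub by blast
      then show "v \<in> S" using u unfolding R_def by auto
    qed
    \<comment> \<open>Dominating the unmatched \<open>a1\<close> and \<open>b1\<close> forces one
      further vertex of \<open>S\<close> on each side, outside \<open>A0\<close> and
      \<open>B0\<close>.\<close>
    obtain y where y: "y \<in> S" "y \<in> B - B0"
      using domA[of a1] a1 unfolding R_def by auto
    obtain x where x: "x \<in> S" "x \<in> A - A0"
      using domB[of b1] b1 fA0 unfolding R_def by auto
    have fin0: "finite A0" "finite B0"
      using sub fin by (auto intro: finite_subset)
    have "card (insert x A0 \<union> insert y B0) = card (insert x A0) + card (insert y B0)"
      using fin0 x y sub disj by (intro card_Un_disjoint) auto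
    also have "\<dots> = 2 * card A0 + 2"
      using fin0 x y bij_betw_same_card[OF f] by simp
    finally have "2 * card A0 + 2 = card (insert x A0 \<union> insert y B0)" ..
    also have "\<dots> \<le> card S"
      using S fin A0S B0S x y unfolding total_dominating_set_def
      by (intro card_mono) (auto intro: finite_subset)
    finally show "2 * card A0 + 2 \<le> card S" .
  qed
qed

theorem theorem3p19:
  fixes V :: "'a set" and E :: "'a set set" and a b k :: nat
  assumes "complete_bipartite_graph a b V E"
    and "k \<ge> 1"
    and "\<lceil>real k / 2\<rceil> + 1 \<le> int a"
    and "a \<le> b"
  shows "k_total_bondage_number k V E
           \<le> enat (nat (\<lceil>real k / 2\<rceil> * (int a + int b - \<lceil>real k / 2\<rceil> - 1)))"
proof -
  obtain A B where fin: "finite A" "finite B" and card: "card A = a" "card B = b"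
    and disj: "A \<inter> B = {}" and V: "V = A \<union> B" and E: "E = pair_edges (A \<times> B)"
    using assms(1) unfolding complete_bipartite_graph_def pair_edges_def by auto
  define m where "m = nat \<lceil>real k / 2\<rceil>"
  have m: "\<lceil>real k / 2\<rceil> = int m"
    unfolding m_def by simp
  have km: "k \<le> 2 * m"
    using le_of_int_ceiling[of "real k / 2"] m by simp
  \<comment> \<open>The summand 1 in the hypothesis makes this strict, so \<open>A0\<close> and
    \<open>B0\<close> below are proper subsets.\<close>
  have ma: "m < a" "m < b"
    using assms(3,4) m by auto
  obtain A0 where A0: "A0 \<subseteq> A" "card A0 = m" "finite A0"
    using obtain_subset_with_card_n[of m A] ma card by auto
  obtain B0 where B0: "B0 \<subseteq> B" "card B0 = m" "finite B0"
    using obtain_subset_with_card_n[of m B] ma card by auto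
  obtain f where f: "bij_betw f A0 B0"
    using A0 B0 finite_same_card_bij by metis
  have sub: "A0 \<subset> A" "B0 \<subset> B"
    using A0 B0 ma card by auto
  define R where "R = (\<lambda>u. (u, f u)) ` A0 \<union> (A - A0) \<times> (B - B0)"
  have R: "R \<subseteq> A \<times> B"
    using A0 B0 f unfolding R_def bij_betw_def by auto
  note dom = matching_plus_bipartite_total_domination[OF fin disj sub f, folded R_def]
  define F where "F = E - pair_edges R"
  have RE: "pair_edges R \<subseteq> E"
    unfolding E using R by (rule pair_edges_mono)
  then have EF: "E - F = pair_edges R"
    unfolding F_def by blast
  have "total_domination_number V E \<le> 2"
    unfolding V E using sub by (intro total_domination_number_complete_bipartite_le) auto
  then have "total_domination_number V E + k \<le> total_domination_number V (E - F)"
    using dom(2) km A0(2) unfolding EF V by linarith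
  moreover have "no_isolated_vertices V (E - F)"
    using dom(1) unfolding EF V .
  ultimately have le: "k_total_bondage_number k V E \<le> enat (card F)"
    by (intro k_total_bondage_number_le) (auto simp: F_def)
  have cardR: "card R = m + (a - m) * (b - m)"
  proof -
    have "card R = card ((\<lambda>u. (u, f u)) ` A0) + card ((A - A0) \<times> (B - B0))"
      \<comment> \<open>The two pieces are disjoint because their first coordinates lie in
        \<open>A0\<close> and in \<open>A - A0\<close>.\<close>
      unfolding R_def using fin A0 by (intro card_Un_disjoint) auto
    also have "card ((\<lambda>u. (u, f u)) ` A0) = m"
      using A0 by (simp add: card_image inj_on_def)
    finally show ?thesis
      using A0 B0 card by (simp add: card_cartesian_product card_Diff_subset)
  qed
  have finE: "finite E"
    using assms(1) complete_bipartite_graph_imp_simple_graph[of a b V E]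
    unfolding simple_graph_def by (meson PowI finite_Pow_iff finite_subset subsetI)
  have "card F + card (pair_edges R) = card E"
    unfolding F_def using RE finE
    by (metis card_Diff_subset card_mono finite_subset le_add_diff_inverse2)
  then have "card F + (m + (a - m) * (b - m)) = a * b"
    using card_pair_edges[OF R disj] card_pair_edges[OF order_refl disj] cardR card
    unfolding E by (simp add: card_cartesian_product)
  \<comment> \<open>Passing to integers is safe since \<open>m < a\<close> and \<open>m < b\<close>
    keep the natural subtractions from truncating. The identity behind the next step is
    \<open>ab - m - (a - m)(b - m) = m(a + b - m - 1)\<close>.\<close>
  then have "int (card F) + (int m + (int a - int m) * (int b - int m)) = int a * int b"
    using ma by (metis (no_types) less_imp_le of_nat_add of_nat_diff of_nat_mult)
  then have "int (card F) = int m * (int a + int b - int m - 1)"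
    by (simp add: algebra_simps)
  then have "card F = nat (\<lceil>real k / 2\<rceil> * (int a + int b - \<lceil>real k / 2\<rceil> - 1))"
    unfolding m by (metis nat_int)
  then show ?thesis
    using le by simp
qed

end
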